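(* Let $\Delta$ be a simplicial complex on the vertex set $\{x_1,\dots,x_n\}$. If $F$ is a leaf of $\Delta$, then $F$ is a splitting facet of $\Delta$.
   Context: A simplicial complex $\Delta$ on $\{x_1,\dots,x_n\}$ is a collection of subsets closed under taking subsets and containing all $\{x_i\}$; facets are its maximal faces, and $\mathcal{F}(\Delta)$ is the set of facets. A facet $F$ also denotes the monomial $\prod_{x\in F}x$ in $R=k[x_1,\dots,x_n]$, $k$ a field. The facet ideal is $\mathcal{I}(\Delta)=(\{F\mid F\in\mathcal{F}(\Delta)\})\subseteq R$. $\Delta\setminus F$ is the complex with facet set $\mathcal{F}(\Delta)\setminus\{F\}$; its facet ideal is viewed in $R$. A facet $F$ of $\Delta$ is a leaf if either $F$ is the only facet of $\Delta$, or there is a facet $G\ne F$ of $\Delta$ such that $F\cap F'\subseteq F\cap G$ for every facet $F'\neq F$ of $\Delta$. $\mathcal{G}(I)$ is the minimal set of monomial generators of a monomial ideal $I$. An expression $I=J+K$ with $J,K$ nonzero monomial ideals is a splitting of $I$ if (1) $\mathcal{G}(I)$ is the disjoint union of $\mathcal{G}(J)$ and $\mathcal{G}(K)$, and (2) there is a function $\mathcal{G}(J\cap K)\to\mathcal{G}(J)\times\mathcal{G}(K)$, $w\mapsto(\phi(w),\psi(w))$, such that (a) $w=\mathrm{lcm}(\phi(w),\psi(w))$ for all $w\in\mathcal{G}(J\cap K)$, and (b) for every nonempty subset $S\subseteq\mathcal{G}(J\cap K)$, both $\mathrm{lcm}(\phi(S))$ and $\mathrm{lcm}(\psi(S))$ strictly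 divide $\mathrm{lcm}(S)$ (divide it and are not equal to it). A facet $F$ of $\Delta$ is a splitting facet of $\Delta$ if $\mathcal{I}(\Delta)=(F)+\mathcal{I}(\Delta\setminus F)$ is a splitting of $\mathcal{I}(\Delta)$.
   Formalization: The formal theorem additionally assumes that F is not the only facet of Δ; if F is the only facet, it is a leaf but the facet ideal of Δ∖F is zero, so by definition F is not a splitting facet. *)

theory Defs
  imports Complex_Main "HOL-Library.Poly_Mapping"
begin

section \<open>Polynomial rings and monomial ideals\<close>

text \<open>The polynomial ring over \<open>'k\<close> whose variables are the elements of \<open>'v\<close>: finitely supported
  functions from exponent vectors to coefficients, with the convolution product. For \<open>'v :: finite\<close>
  with \<open>n\<close> elements and a field \<open>'k\<close> this is \<open>k[x_1,...,x_n]\<close>.\<close>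

type_synonym ('v, 'k) mpoly = "('v \<Rightarrow>\<^sub>0 nat) \<Rightarrow>\<^sub>0 'k"

definition Var :: "'v \<Rightarrow> ('v, 'k::comm_ring_1) mpoly" where
  "Var x = Poly_Mapping.single (Poly_Mapping.single x 1) 1"

definition monomials :: "('v, 'k::comm_ring_1) mpoly set" where
  "monomials = range (\<lambda>e. Poly_Mapping.single e 1)"

lemma module_times: "module ((*) :: 'a::comm_ring_1 \<Rightarrow> 'a \<Rightarrow> 'a)"
  by unfold_locales (auto simp: algebra_simps)

text \<open>The ideal generated by a set, as the submodule it spans in the ring regarded as a module
  over itself.\<close>

definition ideal_of :: "'a::comm_ring_1 set \<Rightarrow> 'a set" where
  "ideal_of S = module.span (*) S"

definition ideal_sum :: "'a::comm_ring_1 set \<Rightarrow> 'a set \<Rightarrow> 'a set" where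
  "ideal_sum J K = {a + b | a b. a \<in> J \<and> b \<in> K}"

definition monomial_ideal :: "('v, 'k::comm_ring_1) mpoly set \<Rightarrow> bool" where
  "monomial_ideal I \<longleftrightarrow> (\<exists>M \<subseteq> monomials. I = ideal_of M)"

text \<open>The minimal set of monomial generators of a monomial ideal is unique, hence the definite
  description; it is meaningful for monomial ideals only.\<close>

definition min_gens :: "('v, 'k::comm_ring_1) mpoly set \<Rightarrow> ('v, 'k) mpoly set" where
  "min_gens I = (THE G. G \<subseteq> monomials \<and> ideal_of G = I \<and> (\<forall>G' \<subset> G. ideal_of G' \<noteq> I))"

text \<open>The least common multiple in the polynomial ring of a finite set of monomials; it is determined
  up to a unit, and we take the representative that is a monomial (with coefficient 1).\<close>

definition mono_lcm :: "('v, 'k::comm_ring_1) mpoly set \<Rightarrow> ('v, 'k) mpoly" where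
  "mono_lcm S = (THE m. m \<in> monomials \<and> (\<forall>s\<in>S. s dvd m) \<and>
                        (\<forall>p. (\<forall>s\<in>S. s dvd p) \<longrightarrow> m dvd p))"

definition strictly_divides :: "'a::comm_ring_1 \<Rightarrow> 'a \<Rightarrow> bool" where
  "strictly_divides a b \<longleftrightarrow> a dvd b \<and> a \<noteq> b"

text \<open>\<open>is_splitting I J K\<close>: the expression \<open>I = J + K\<close> is a splitting of \<open>I\<close>.\<close>

definition is_splitting ::
  "('v, 'k::comm_ring_1) mpoly set \<Rightarrow> ('v, 'k) mpoly set \<Rightarrow> ('v, 'k) mpoly set \<Rightarrow> bool" where
  "is_splitting I J K \<longleftrightarrow>
     monomial_ideal J \<and> J \<noteq> {0} \<and> monomial_ideal K \<and> K \<noteq> {0} \<and> I = ideal_sum J K \<and>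
     min_gens I = min_gens J \<union> min_gens K \<and> min_gens J \<inter> min_gens K = {} \<and>
     (\<exists>\<phi> \<psi>.
        (\<forall>w \<in> min_gens (J \<inter> K). \<phi> w \<in> min_gens J \<and> \<psi> w \<in> min_gens K \<and>
                               w = mono_lcm {\<phi> w, \<psi> w}) \<and>
        (\<forall>S \<subseteq> min_gens (J \<inter> K). S \<noteq> {} \<longrightarrow>
           strictly_divides (mono_lcm (\<phi> ` S)) (mono_lcm S) \<and>
           strictly_divides (mono_lcm (\<psi> ` S)) (mono_lcm S)))"


section \<open>Simplicial complexes and facet ideals\<close>

text \<open>The vertex set is the whole type \<open>'v\<close>.\<close>

definition simplicial_complex :: "'v set set \<Rightarrow> bool" where
  "simplicial_complex \<Delta> \<longleftrightarrow> (\<forall>F\<in>\<Delta>. \<forall>G\<subseteq>F. G \<in> \<Delta>) \<and> (\<forall>x. {x} \<in> \<Delta>)"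

definition facets :: "'v set set \<Rightarrow> 'v set set" where
  "facets \<Delta> = {F \<in> \<Delta>. \<forall>G\<in>\<Delta>. F \<subseteq> G \<longrightarrow> G = F}"

text \<open>\<open>remove_facet \<Delta> F\<close> is generated by the facets of \<open>\<Delta>\<close> other than \<open>F\<close>. It need not contain every
  vertex, and it has no faces at all if \<open>F\<close> is the only facet.\<close>

definition remove_facet :: "'v set set \<Rightarrow> 'v set \<Rightarrow> 'v set set" where
  "remove_facet \<Delta> F = {H. \<exists>G \<in> facets \<Delta> - {F}. H \<subseteq> G}"

definition leaf :: "'v set set \<Rightarrow> 'v set \<Rightarrow> bool" where
  "leaf \<Delta> F \<longleftrightarrow> F \<in> facets \<Delta> \<and>
     (facets \<Delta> = {F} \<or>
      (\<exists>G \<in> facets \<Delta>. G \<noteq> F \<and> (\<forall>F' \<in> facets \<Delta>. F' \<noteq> F \<longrightarrow> F \<inter> F' \<subseteq> F \<inter> G)))"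

definition face_monomial :: "'v set \<Rightarrow> ('v, 'k::comm_ring_1) mpoly" where
  "face_monomial F = (\<Prod>x\<in>F. Var x)"

definition facet_ideal :: "'v set set \<Rightarrow> ('v, 'k::comm_ring_1) mpoly set" where
  "facet_ideal \<Delta> = ideal_of (face_monomial ` facets \<Delta>)"

text \<open>The type argument fixes the coefficient field.\<close>

definition splitting_facet :: "'k::field itself \<Rightarrow> 'v set set \<Rightarrow> 'v set \<Rightarrow> bool" where
  "splitting_facet _ \<Delta> F \<longleftrightarrow> F \<in> facets \<Delta> \<and>
     is_splitting (facet_ideal \<Delta> :: ('v, 'k) mpoly set)
                  (ideal_of {face_monomial F}) (facet_ideal (remove_facet \<Delta> F))"

text \<open>If \<open>F\<close> is the only facet, then \<open>facet_ideal (remove_facet \<Delta> F)\<close> is the zero ideal. As both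
  summands of a splitting have to be nonzero, \<open>F\<close> is then not a splitting facet (although it is a
  leaf).\<close>

lemma splitting_facet_imp_not_only_facet:
  fixes \<Delta> :: "'v set set"
  assumes "splitting_facet TYPE('k::field) \<Delta> F"
  shows "facets \<Delta> \<noteq> {F}"
proof
  assume "facets \<Delta> = {F}"
  then have "facets (remove_facet \<Delta> F) = {}"
    by (simp add: remove_facet_def facets_def)
  then have "(facet_ideal (remove_facet \<Delta> F) :: ('v, 'k) mpoly set) = {0}"
    by (simp add: facet_ideal_def ideal_of_def module.span_empty[OF module_times])
  with assms show False
    by (simp add: splitting_facet_def is_splitting_def)
qed

end

theory Submission
  imports Defs
begin

text \<open>A polynomial lies in a monomial ideal iff each of its exponents dominates the exponent of some
  generator, so everything about squarefree monomials reduces to sets of variables. Writing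
  \<open>G\<close> for the facet witnessing that \<open>F\<close> is a leaf, the minimal generators of \<open>(F) \<inter> \<I>(\<Delta> \<setminus> F)\<close> are
  the minimal unions \<open>F \<union> F'\<close>, and we split \<open>w = F \<union> F'\<close> into \<open>\<phi>(w) = F\<close> and \<open>\<psi>(w) = F'\<close>. Then
  \<open>lcm (\<phi>(S)) = F\<close> misses a vertex of \<open>F'\<close>; and \<open>lcm (\<psi>(S))\<close> meets \<open>F\<close> only inside \<open>F \<inter> G\<close>, which is
  not all of \<open>F\<close>.\<close>

abbreviation mon :: "('v \<Rightarrow>\<^sub>0 nat) \<Rightarrow> ('v, 'k::comm_ring_1) mpoly" where
  "mon e \<equiv> Poly_Mapping.single e 1"

abbreviation lookup :: "('a \<Rightarrow>\<^sub>0 'b::zero) \<Rightarrow> 'a \<Rightarrow> 'b" where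
  "lookup \<equiv> Poly_Mapping.lookup"

abbreviation keys :: "('a \<Rightarrow>\<^sub>0 'b::zero) \<Rightarrow> 'a set" where
  "keys \<equiv> Poly_Mapping.keys"

section \<open>Monomial ideals\<close>

lemma lookup_le_iff_add:
  fixes a e :: "'v \<Rightarrow>\<^sub>0 nat"
  shows "lookup a \<le> lookup e \<longleftrightarrow> (\<exists>c. e = c + a)"
proof
  assume "lookup a \<le> lookup e"
  \<comment> \<open>Subtraction of exponents is truncated, so this identity holds only because
    \<open>a\<close> lies pointwise below \<open>e\<close>.\<close>
  then have "e = (e - a) + a"
    by (intro poly_mapping_eqI) (simp add: lookup_add lookup_minus le_fun_def)
  then show "\<exists>c. e = c + a" ..
qed (auto simp: le_fun_def lookup_add)

text \<open>Multiplying a generator only raises its exponent, and cancellation in a sum can only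
  remove keys; hence the condition survives the induction over the span. Conversely,
  \<open>p\<close> is the sum of its terms, and each term is a multiple of a generator.\<close>

lemma mem_ideal_of_mon_iff:
  fixes p :: "('v, 'k::comm_ring_1) mpoly"
  shows "p \<in> ideal_of (mon ` A) \<longleftrightarrow> (\<forall>e\<in>keys p. \<exists>a\<in>A. lookup a \<le> lookup e)"
proof
  assume "p \<in> ideal_of (mon ` A)"
  then have "p \<in> module.span (*) (mon ` A)"
    by (simp add: ideal_of_def)
  then show "\<forall>e\<in>keys p. \<exists>a\<in>A. lookup a \<le> lookup e"
  proof (induction rule: module.span_induct_alt[OF module_times, consumes 1, case_names zero step])
    case zero
    show ?case by simp
  next
    case (step c q r)
    show ?case
    proof
      fix e assume "e \<in> keys (c * q + r)"
      then have "e \<in> keys (c * q) \<or> e \<in> keys r"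
        using subsetD[OF Poly_Mapping.keys_add, of e "c * q" r] by simp
      then show "\<exists>a\<in>A. lookup a \<le> lookup e"
      proof
        assume "e \<in> keys (c * q)"
        then obtain d b where "e = d + b" "b \<in> keys q"
          using subsetD[OF keys_mult, of e c q] by auto
        moreover obtain a where "a \<in> A" "q = mon a"
          using step(1) by blast
        ultimately have "a \<in> A" "e = d + a"
          by simp_all
        then show ?thesis
          using lookup_le_iff_add by blast
      qed (use step in blast)
    qed
  qed
next
  assume *: "\<forall>e\<in>keys p. \<exists>a\<in>A. lookup a \<le> lookup e"
  have "Poly_Mapping.single e (lookup p e) \<in> ideal_of (mon ` A)" if e: "e \<in> keys p" for e
  proof -
    obtain a c where a: "a \<in> A" "e = c + a"
      using * e by (meson lookup_le_iff_add)
    then have "Poly_Mapping.single e (lookup p e) = Poly_Mapping.single c (lookup p e) * mon a"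
      by (simp add: mult_single)
    then show ?thesis
      unfolding ideal_of_def
      by (auto intro!: a(1) module.span_base[OF module_times] module.span_scale[OF module_times])
  qed
  then have "(\<Sum>e\<in>keys p. Poly_Mapping.single e (lookup p e)) \<in> ideal_of (mon ` A)"
    unfolding ideal_of_def by (intro module.span_sum[OF module_times])
  moreover have "(\<Sum>e\<in>keys p. Poly_Mapping.single e (lookup p e)) = p"
    by (intro poly_mapping_eqI) (simp add: lookup_sum lookup_single when_def in_keys_iff)
  ultimately show "p \<in> ideal_of (mon ` A)" by simp
qed

lemma mon_mem_ideal_of_iff:
  "(mon e :: ('v, 'k::comm_ring_1) mpoly) \<in> ideal_of (mon ` A)
    \<longleftrightarrow> (\<exists>a\<in>A. lookup a \<le> lookup e)"
  by (simp add: mem_ideal_of_mon_iff)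

text \<open>Divisibility by a monomial is membership in the principal ideal it generates, so the
  exponent criterion applies.\<close>

lemma mon_dvd_iff:
  "(mon a :: ('v, 'k::comm_ring_1) mpoly) dvd p \<longleftrightarrow> (\<forall>e\<in>keys p. lookup a \<le> lookup e)"
proof -
  have "mon a dvd p \<longleftrightarrow> p \<in> ideal_of (mon ` {a})"
    by (auto simp: ideal_of_def module.span_singleton[OF module_times] dvd_def mult.commute)
  then show ?thesis
    by (simp only: mem_ideal_of_mon_iff) simp
qed

text \<open>Serves to discard redundant generators, namely those lying above one that is
  kept.\<close>

lemma ideal_of_mon_eqI:
  fixes A B :: "('v \<Rightarrow>\<^sub>0 nat) set"
  assumes "A \<subseteq> B" "\<And>b. b \<in> B \<Longrightarrow> \<exists>a\<in>A. lookup a \<le> lookup b"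
  shows "(ideal_of (mon ` A) :: ('v, 'k::comm_ring_1) mpoly set) = ideal_of (mon ` B)"
proof -
  have "(\<exists>a\<in>A. lookup a \<le> lookup e) \<longleftrightarrow> (\<exists>b\<in>B. lookup b \<le> lookup e)" for e
    using assms by (meson order_trans subsetD)
  then show ?thesis
    by (simp add: set_eq_iff mem_ideal_of_mon_iff)
qed

text \<open>Evaluating the definite description takes two facts. Irredundancy: a removed
  \<open>a\<close> would have to dominate another element of the antichain. Uniqueness: for a
  competitor \<open>mon\<close>
  B\<open>, each\<close>a\<open>dominates some\<close>b\<open>, which dominates some\<close>a'\<open>; the antichain forces\<close>a'
  = a\<open>, hence\<close>b = a\<open>. So the competitor contains\<close>mon \<open>A\<close>, and
  its own irredundancy gives equality.\<close>

lemma min_gens_ideal_of_antichain: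
  fixes A :: "('v \<Rightarrow>\<^sub>0 nat) set"
  assumes antichain: "\<And>a b. a \<in> A \<Longrightarrow> b \<in> A \<Longrightarrow> lookup a \<le> lookup b \<Longrightarrow> a = b"
  shows "min_gens (ideal_of (mon ` A)) = (mon ` A :: ('v, 'k::comm_ring_1) mpoly set)"
  unfolding min_gens_def
proof (rule the_equality)
  let ?I = "ideal_of (mon ` A) :: ('v, 'k) mpoly set"
  have "ideal_of G \<noteq> ?I" if G: "G \<subset> mon ` A" for G :: "('v, 'k) mpoly set"
  proof
    assume eq: "ideal_of G = ?I"
    from G have "G \<subseteq> mon ` A" by blast
    then obtain B where B: "B \<subseteq> A" "G = mon ` B"
      by (auto simp: subset_image_iff)
    then obtain a where a: "a \<in> A" "a \<notin> B"
      using G by blast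
    then have "mon a \<in> ideal_of G"
      by (auto simp: eq mon_mem_ideal_of_iff)
    then obtain b where "b \<in> B" "lookup b \<le> lookup a"
      by (auto simp: B(2) mon_mem_ideal_of_iff)
    then show False
      using antichain a B(1) by blast
  qed
  then show "mon ` A \<subseteq> monomials \<and> ideal_of (mon ` A) = ?I \<and> (\<forall>G'\<subset>mon ` A. ideal_of G' \<noteq> ?I)"
    by (auto simp: monomials_def)
next
  fix G :: "('v, 'k) mpoly set"
  assume G: "G \<subseteq> monomials \<and> ideal_of G = ideal_of (mon ` A) \<and>
    (\<forall>G'\<subset>G. ideal_of G' \<noteq> ideal_of (mon ` A))"
  then obtain B where B: "G = mon ` B"
    unfolding monomials_def by (auto simp: subset_image_iff)
  have "A \<subseteq> B"
  proof
    fix a assume a: "a \<in> A"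
    then have "(mon a :: ('v, 'k) mpoly) \<in> ideal_of (mon ` B)"
      using G by (auto simp: B mon_mem_ideal_of_iff)
    then obtain b where b: "b \<in> B" "lookup b \<le> lookup a"
      by (auto simp: mon_mem_ideal_of_iff)
    then have "(mon b :: ('v, 'k) mpoly) \<in> ideal_of (mon ` A)"
      using G unfolding B by (metis mon_mem_ideal_of_iff order_refl)
    then obtain a' where a': "a' \<in> A" "lookup a' \<le> lookup b"
      by (auto simp: mon_mem_ideal_of_iff)
    then have "a' = a"
      using a b antichain order_trans by blast
    then have "lookup a = lookup b"
      using a' b by (simp add: order_antisym)
    then show "a \<in> B"
      using b(1) by (simp add: lookup_inject)
  qed
  then have "mon ` A \<subseteq> G"
    unfolding B by (rule image_mono)
  then show "G = mon ` A"
    using G psubsetI by metis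
qed

section \<open>Squarefree monomials\<close>

text \<open>The exponent vector of the squarefree monomial of \<open>F\<close>; it turns
  divisibility into inclusion of vertex sets.\<close>

definition ind :: "'v::finite set \<Rightarrow> 'v \<Rightarrow>\<^sub>0 nat" where
  "ind F = (\<Sum>x\<in>F. Poly_Mapping.single x 1)"

lemma lookup_ind: "lookup (ind F) x = (if x \<in> F then 1 else 0)"
  by (simp add: ind_def lookup_sum lookup_single when_def)

lemma lookup_ind_le_iff: "lookup (ind F) \<le> lookup (ind G) \<longleftrightarrow> F \<subseteq> G"
  by (auto simp: le_fun_def lookup_ind split: if_splits)

lemma ind_eq_iff: "ind F = ind G \<longleftrightarrow> F = G"
  by (metis lookup_ind_le_iff order_refl subset_antisym)

text \<open>Here \<open>e\<close> need not be squarefree: indicators take only the values 0 and 1,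
  so the union is their least upper bound among all exponent vectors. This is why unions compute
  least common multiples.\<close>

lemma lookup_ind_Union_le_iff:
  "lookup (ind (\<Union>\<A>)) \<le> lookup e \<longleftrightarrow> (\<forall>A\<in>\<A>. lookup (ind A) \<le> lookup e)"
  by (auto simp: le_fun_def lookup_ind)

lemma lookup_ind_Un_le_iff:
  "lookup (ind (A \<union> B)) \<le> lookup e \<longleftrightarrow> lookup (ind A) \<le> lookup e \<and> lookup (ind B) \<le> lookup e"
  using lookup_ind_Union_le_iff[of "{A, B}"] by simp

lemma face_monomial_eq_mon:
  "(face_monomial F :: ('v::finite, 'k::comm_ring_1) mpoly) = mon (ind F)"
proof -
  have "finite F" by simp
  then show ?thesis
    unfolding face_monomial_def ind_def
    by (induction rule: finite_induct) (simp_all add: Var_def mult_single)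
qed

lemma face_monomial_image_eq:
  "(face_monomial ` \<A> :: ('v::finite, 'k::comm_ring_1) mpoly set) = mon ` ind ` \<A>"
  by (simp add: image_image face_monomial_eq_mon)

lemma face_monomial_eq_iff:
  "(face_monomial F :: ('v::finite, 'k::comm_ring_1) mpoly) = face_monomial G \<longleftrightarrow> F = G"
proof
  assume "(face_monomial F :: ('v, 'k) mpoly) = face_monomial G"
  \<comment> \<open>Since 1 is nonzero, the support of a monomial is exactly its one
    exponent.\<close>
  then have "keys (mon (ind F) :: ('v, 'k) mpoly) = keys (mon (ind G) :: ('v, 'k) mpoly)"
    by (simp only: face_monomial_eq_mon)
  then show "F = G"
    by (simp add: ind_eq_iff)
qed simp

lemma face_monomial_dvd_iff:
  "(face_monomial F :: ('v::finite, 'k::comm_ring_1) mpoly) dvd face_monomial G \<longleftrightarrow> F \<subseteq> G"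
  by (simp add: face_monomial_eq_mon mon_dvd_iff lookup_ind_le_iff)

lemma strictly_divides_face_monomial_iff:
  "strictly_divides (face_monomial F :: ('v::finite, 'k::comm_ring_1) mpoly) (face_monomial G)
    \<longleftrightarrow> F \<subset> G"
  by (simp add: strictly_divides_def face_monomial_dvd_iff face_monomial_eq_iff psubset_eq)

lemma mono_lcm_face_monomial:
  "mono_lcm (face_monomial ` \<A>) = (face_monomial (\<Union>\<A>) :: ('v::finite, 'k::comm_ring_1) mpoly)"
  unfolding mono_lcm_def
proof (rule the_equality)
  let ?m = "face_monomial (\<Union>\<A>) :: ('v, 'k) mpoly"
  have dvd: "?m dvd p" if "\<forall>s\<in>face_monomial ` \<A>. s dvd p" for p
    using that by (auto simp: face_monomial_eq_mon mon_dvd_iff lookup_ind_Union_le_iff)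
  have ub: "\<forall>s\<in>face_monomial ` \<A>. s dvd ?m"
    by (auto simp: face_monomial_dvd_iff)
  show "?m \<in> monomials \<and> (\<forall>s\<in>face_monomial ` \<A>. s dvd ?m) \<and>
    (\<forall>p. (\<forall>s\<in>face_monomial ` \<A>. s dvd p) \<longrightarrow> ?m dvd p)"
    using dvd ub by (auto simp: monomials_def face_monomial_eq_mon)
  fix m :: "('v, 'k) mpoly"
  assume m: "m \<in> monomials \<and> (\<forall>s\<in>face_monomial ` \<A>. s dvd m) \<and>
    (\<forall>p. (\<forall>s\<in>face_monomial ` \<A>. s dvd p) \<longrightarrow> m dvd p)"
  then obtain e where e: "m = mon e"
    by (auto simp: monomials_def)
  \<comment> \<open>Uniqueness: two monomials with coefficient 1 that divide each other have the
    same exponent.\<close>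
  have "m dvd ?m" "?m dvd m"
    using m ub dvd by blast+
  then have "lookup e = lookup (ind (\<Union>\<A>))"
    unfolding e face_monomial_eq_mon by (simp add: mon_dvd_iff order_antisym)
  then show "m = ?m"
    by (simp add: e face_monomial_eq_mon lookup_inject)
qed

lemma min_gens_ideal_of_face_monomial:
  assumes "\<And>A B. A \<in> \<A> \<Longrightarrow> B \<in> \<A> \<Longrightarrow> A \<subseteq> B \<Longrightarrow> A = B"
  shows "min_gens (ideal_of (face_monomial ` \<A>))
    = (face_monomial ` \<A> :: ('v::finite, 'k::comm_ring_1) mpoly set)"
  unfolding face_monomial_image_eq
proof (rule min_gens_ideal_of_antichain)
  fix a b assume "a \<in> ind ` \<A>" "b \<in> ind ` \<A>" and le: "lookup a \<le> lookup b"
  then obtain A B where AB: "A \<in> \<A>" "B \<in> \<A>" "a = ind A" "b = ind B" by blast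
  then have "A \<subseteq> B"
    using le by (simp add: lookup_ind_le_iff)
  then show "a = b"
    using AB assms by blast
qed

text \<open>Membership is tested term by term, and an exponent dominates both \<open>ind F\<close>
  and \<open>ind A\<close> exactly when it dominates the indicator of their union.\<close>

lemma ideal_of_face_monomial_Int:
  "ideal_of {face_monomial F} \<inter> ideal_of (face_monomial ` \<A>)
    = (ideal_of (face_monomial ` (\<union>) F ` \<A>) :: ('v::finite, 'k::comm_ring_1) mpoly set)"
proof (rule set_eqI)
  fix p :: "('v, 'k) mpoly"
  have "p \<in> ideal_of {face_monomial F} \<longleftrightarrow> (\<forall>e\<in>keys p. lookup (ind F) \<le> lookup e)"
    using mem_ideal_of_mon_iff[of p "{ind F}"] by (simp add: face_monomial_eq_mon)
  moreover have "p \<in> ideal_of (face_monomial ` \<A>)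
      \<longleftrightarrow> (\<forall>e\<in>keys p. \<exists>A\<in>\<A>. lookup (ind A) \<le> lookup e)"
    unfolding face_monomial_image_eq mem_ideal_of_mon_iff by simp
  moreover have "p \<in> ideal_of (face_monomial ` (\<union>) F ` \<A>)
      \<longleftrightarrow> (\<forall>e\<in>keys p. lookup (ind F) \<le> lookup e \<and> (\<exists>A\<in>\<A>. lookup (ind A) \<le> lookup e))"
    unfolding face_monomial_image_eq mem_ideal_of_mon_iff by (simp add: lookup_ind_Un_le_iff)
  ultimately show "p \<in> ideal_of {face_monomial F} \<inter> ideal_of (face_monomial ` \<A>)
      \<longleftrightarrow> p \<in> ideal_of (face_monomial ` (\<union>) F ` \<A>)"
    by auto
qed

text \<open>Over finitely many vertices every member of \<open>\<A>\<close> contains a minimal one.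
  This replaces a family of generators by an antichain, whose \<open>min_gens\<close> is
  known.\<close>

lemma ideal_of_face_monomial_minimal:
  "(ideal_of (face_monomial ` {A \<in> \<A>. \<forall>B\<in>\<A>. B \<subseteq> A \<longrightarrow> B = A})
      :: ('v::finite, 'k::comm_ring_1) mpoly set)
    = ideal_of (face_monomial ` \<A>)"
  unfolding face_monomial_image_eq
proof (rule ideal_of_mon_eqI)
  fix b assume "b \<in> ind ` \<A>"
  then obtain B where B: "B \<in> \<A>" "b = ind B" by blast
  obtain A where "A \<in> \<A>" "A \<subseteq> B" "\<forall>C\<in>\<A>. C \<subseteq> A \<longrightarrow> A = C"
    using finite_has_minimal2[of \<A> B] B(1) by auto
  then show "\<exists>a\<in>ind ` {A \<in> \<A>. \<forall>B\<in>\<A>. B \<subseteq> A \<longrightarrow> B = A}. lookup a \<le> lookup b"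
    unfolding B(2) by (intro bexI[of _ "ind A"] imageI) (simp add: lookup_ind_le_iff, blast)
qed auto

lemma monomial_ideal_face_monomial:
  "monomial_ideal (ideal_of (face_monomial ` \<A>) :: ('v::finite, 'k::comm_ring_1) mpoly set)"
  unfolding monomial_ideal_def monomials_def face_monomial_image_eq
  by (rule exI[of _ "mon ` ind ` \<A>"]) auto

lemma ideal_of_face_monomial_nonzero:
  assumes "A \<in> \<A>"
  shows "(ideal_of (face_monomial ` \<A>) :: ('v::finite, 'k::comm_ring_1) mpoly set) \<noteq> {0}"
proof -
  have "(face_monomial A :: ('v, 'k) mpoly) \<in> ideal_of (face_monomial ` \<A>)"
    unfolding ideal_of_def by (intro module.span_base[OF module_times] imageI assms)
  moreover have "(face_monomial A :: ('v, 'k) mpoly) \<noteq> 0"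
    by (simp add: face_monomial_eq_mon flip: keys_eq_empty)
  ultimately show ?thesis by blast
qed

section \<open>Leaves are splitting facets\<close>

lemma facets_antichain: "A \<in> facets \<Delta> \<Longrightarrow> B \<in> facets \<Delta> \<Longrightarrow> A \<subseteq> B \<Longrightarrow> A = B"
  by (auto simp: facets_def)

text \<open>The remaining facets are pairwise incomparable, so each stays maximal in the complex
  they generate.\<close>

lemma facets_remove_facet: "facets (remove_facet \<Delta> F) = facets \<Delta> - {F}"
proof (intro set_eqI iffI)
  fix H assume H: "H \<in> facets (remove_facet \<Delta> F)"
  then obtain G where G: "G \<in> facets \<Delta> - {F}" "H \<subseteq> G"
    by (auto simp: facets_def remove_facet_def)
  then have "G \<in> remove_facet \<Delta> F"
    by (auto simp: remove_facet_def)
  then have "G = H"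
    using H G(2) by (auto simp: facets_def)
  then show "H \<in> facets \<Delta> - {F}"
    using G(1) by simp
next
  fix H assume H: "H \<in> facets \<Delta> - {F}"
  have "G = H" if "G \<in> remove_facet \<Delta> F" "H \<subseteq> G" for G
  proof -
    obtain G' where G': "G' \<in> facets \<Delta>" "G \<subseteq> G'"
      using \<open>G \<in> remove_facet \<Delta> F\<close> by (auto simp: remove_facet_def)
    then have "H = G'"
      using H \<open>H \<subseteq> G\<close> facets_antichain by blast
    then show ?thesis
      using \<open>H \<subseteq> G\<close> G'(2) by blast
  qed
  moreover have "H \<in> remove_facet \<Delta> F"
    using H by (auto simp: remove_facet_def)
  ultimately show "H \<in> facets (remove_facet \<Delta> F)"
    unfolding facets_def by blast
qed

theorem theorem5p6:
  fixes \<Delta> :: "'v::finite set set" and F :: "'v set"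
  assumes "simplicial_complex \<Delta>"
    and "leaf \<Delta> F"
    and "facets \<Delta> \<noteq> {F}"
  shows "splitting_facet TYPE('k::field) \<Delta> F"
proof -
  let ?fm = "face_monomial :: 'v set \<Rightarrow> ('v, 'k) mpoly"
  define \<A> where "\<A> = facets \<Delta> - {F}"
  \<comment> \<open>Unions of \<open>F\<close> with different facets may be comparable, so only the
    minimal ones can be minimal generators of the intersection.\<close>
  define \<M> where "\<M> = {A \<in> (\<union>) F ` \<A>. \<forall>B\<in>(\<union>) F ` \<A>. B \<subseteq> A \<longrightarrow> B = A}"
  let ?J = "ideal_of {?fm F}" and ?K = "ideal_of (?fm ` \<A>)"
  \<comment> \<open>As \<open>F\<close> is not the only facet, the leaf condition supplies
    \<open>G\<close>; its existence also makes \<open>?K\<close> nonzero.\<close>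
  obtain G where F: "F \<in> facets \<Delta>" and G: "G \<in> \<A>"
    and leaf: "\<And>F'. F' \<in> \<A> \<Longrightarrow> F \<inter> F' \<subseteq> F \<inter> G"
    using assms(2,3) unfolding leaf_def \<A>_def by (metis DiffE DiffI empty_iff insert_iff)
  have facets: "facets \<Delta> = insert F \<A>"
    using F by (auto simp: \<A>_def)
  have gens_I: "min_gens (facet_ideal \<Delta>) = ?fm ` facets \<Delta>"
    unfolding facet_ideal_def by (intro min_gens_ideal_of_face_monomial facets_antichain)
  have gens_J: "min_gens ?J = {?fm F}"
    using min_gens_ideal_of_face_monomial[of "{F}"] by simp
  have gens_K: "min_gens ?K = ?fm ` \<A>"
    by (intro min_gens_ideal_of_face_monomial) (auto simp: \<A>_def dest: facets_antichain)
  have "?J \<inter> ?K = ideal_of (?fm ` \<M>)"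
    unfolding \<M>_def ideal_of_face_monomial_minimal by (rule ideal_of_face_monomial_Int)
  moreover have "min_gens (ideal_of (?fm ` \<M>)) = ?fm ` \<M>"
    by (intro min_gens_ideal_of_face_monomial) (auto simp: \<M>_def)
  ultimately have gens_JK: "min_gens (?J \<inter> ?K) = ?fm ` \<M>" by simp
  \<comment> \<open>Several facets may give the same union; \<open>h\<close> fixes an arbitrary
    choice.\<close>
  have "\<exists>F'. F' \<in> \<A> \<and> A = F \<union> F'" if "A \<in> \<M>" for A
    using that by (auto simp: \<M>_def)
  then obtain h where h: "\<And>A. A \<in> \<M> \<Longrightarrow> h A \<in> \<A> \<and> A = F \<union> h A"
    by metis
  define \<phi> where "\<phi> = (\<lambda>_ :: ('v, 'k) mpoly. ?fm F)"
  \<comment> \<open>The inverse of the injective map \<open>?fm\<close> recovers the vertex set of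
    \<open>w\<close>, on which \<open>h\<close> operates.\<close>
  define \<psi> where "\<psi> = (\<lambda>w. ?fm (h (inv ?fm w)))"
  have inv_fm: "inv ?fm (?fm A) = A" for A
    by (intro inv_f_f injI) (simp add: face_monomial_eq_iff)
  have split: "\<phi> w \<in> min_gens ?J \<and> \<psi> w \<in> min_gens ?K \<and> w = mono_lcm {\<phi> w, \<psi> w}"
    if w: "w \<in> min_gens (?J \<inter> ?K)" for w
  proof -
    obtain A where A: "A \<in> \<M>" "w = ?fm A"
      using w by (auto simp: gens_JK)
    have "mono_lcm {\<phi> w, \<psi> w} = ?fm (F \<union> h A)"
      using mono_lcm_face_monomial[of "{F, h A}"] by (simp add: \<phi>_def \<psi>_def A(2) inv_fm)
    then show ?thesis
      using h[OF A(1)] by (simp add: gens_J gens_K A(2) \<phi>_def \<psi>_def inv_fm)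
  qed
  have strict: "strictly_divides (mono_lcm (\<phi> ` S)) (mono_lcm S) \<and>
      strictly_divides (mono_lcm (\<psi> ` S)) (mono_lcm S)"
    if S: "S \<subseteq> min_gens (?J \<inter> ?K)" "S \<noteq> {}" for S
  proof -
    obtain \<S> where \<S>: "\<S> \<subseteq> \<M>" "S = ?fm ` \<S>"
      using S(1) unfolding gens_JK by (auto simp: subset_image_iff)
    then obtain A where A: "A \<in> \<S>" using S(2) by blast
    \<comment> \<open>Nonemptiness of \<open>S\<close> enters here: the constant map
      \<open>\<phi>\<close> has a one-element image.\<close>
    have "\<phi> ` S = ?fm ` {F}" "\<psi> ` S = ?fm ` h ` \<S>"
      using S(2) by (auto simp: \<phi>_def \<psi>_def \<S>(2) inv_fm image_image)
    then have lcms: "mono_lcm (\<phi> ` S) = ?fm F" "mono_lcm (\<psi> ` S) = ?fm (\<Union>(h ` \<S>))"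
      "mono_lcm S = ?fm (\<Union>\<S>)"
      using \<S>(2) by (simp_all only: mono_lcm_face_monomial) simp
    have h\<S>: "h B \<in> \<A>" "B = F \<union> h B" if "B \<in> \<S>" for B
      using h \<S>(1) that by blast+
    \<comment> \<open>Distinct facets are incomparable, and both \<open>h A\<close> and
      \<open>G\<close> differ from \<open>F\<close>.\<close>
    have not_le: "\<not> h A \<subseteq> F" "\<not> F \<subseteq> G"
      using h\<S>(1)[OF A] G F facets_antichain unfolding \<A>_def by blast+
    have le: "F \<union> h A \<subseteq> \<Union>\<S>" "\<Union>(h ` \<S>) \<subseteq> \<Union>\<S>"
      using h\<S>(2) A by blast+
    \<comment> \<open>The key use of the leaf: one \<open>G\<close> bounds the traces on
      \<open>F\<close> of all chosen facets at once, so even their union cannot cover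
      \<open>F\<close>.\<close>
    have "F \<inter> \<Union>(h ` \<S>) \<subseteq> G"
      using h\<S>(1) leaf by blast
    then have "\<not> F \<subseteq> \<Union>(h ` \<S>)"
      using not_le(2) by (metis inf.absorb1)
    \<comment> \<open>The first inclusion is strict because of a vertex of \<open>h A\<close>
      outside \<open>F\<close>, the second because of a vertex of \<open>F\<close> missed by all
      \<open>h B\<close>.\<close>
    then have "F \<subset> \<Union>\<S>" "\<Union>(h ` \<S>) \<subset> \<Union>\<S>"
      using le not_le(1) by (simp_all add: psubset_eq) (metis le_supE)+
    then show ?thesis
      by (simp add: lcms strictly_divides_face_monomial_iff)
  qed
  have "facet_ideal \<Delta> = ideal_sum ?J ?K"
    unfolding facet_ideal_def facets ideal_sum_def ideal_of_def
    using module.span_Un[OF module_times, of "?fm ` {F}" "?fm ` \<A>"] by auto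
  moreover have "min_gens (facet_ideal \<Delta>) = min_gens ?J \<union> min_gens ?K"
    by (simp add: gens_I gens_K gens_J facets)
  moreover have "min_gens ?J \<inter> min_gens ?K = {}"
    unfolding gens_J gens_K by (auto simp: \<A>_def face_monomial_eq_iff)
  moreover have "monomial_ideal ?J" "?J \<noteq> {0}"
    using monomial_ideal_face_monomial[of "{F}"] ideal_of_face_monomial_nonzero[of F "{F}"]
    by simp_all
  moreover have "monomial_ideal ?K" "?K \<noteq> {0}"
    by (rule monomial_ideal_face_monomial) (rule ideal_of_face_monomial_nonzero[OF G])
  ultimately have "is_splitting (facet_ideal \<Delta>) ?J ?K"
    unfolding is_splitting_def
    using split strict
    by (intro conjI exI[of _ \<phi>] exI[of _ \<psi>]) simp_all
  moreover have "facet_ideal (remove_facet \<Delta> F) = ?K"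
    by (simp add: facet_ideal_def facets_remove_facet \<A>_def)
  ultimately show ?thesis
    using F by (simp add: splitting_facet_def)
qed

end
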